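(* Let $R$ be a $p\times p$ correlation matrix, let $v\sim\mathcal{N}(0,R)$, and let $r\in\mathbb{R}^p$ have entries $r_i=\Phi(v_i)$, where $\Phi$ is the standard normal cumulative distribution function (so $r$ is distributed according to a Gaussian copula with correlation matrix $R$). If $\Sigma$ is the covariance matrix of $r$, then $$\|\Sigma\|_2\le\frac1{2\pi}\Big(\frac{\|R\|_2}{2}+4\|R\|_2^2\Big(\frac\pi6-\frac12\Big)\Big).$$
   Context: $\|\cdot\|_2$ denotes the operator norm. A correlation matrix is a positive semidefinite matrix with all diagonal entries equal to $1$. *)

theory Defs
  imports "HOL-Probability.Probability"
begin

text \<open>Correlation matrix: symmetric positive semidefinite, unit diagonal.\<close>
definition correlation_matrix :: "real^'n^'n \<Rightarrow> bool" where
  "correlation_matrix R \<longleftrightarrow> transpose R = R \<and> (\<forall>x. 0 \<le> x \<bullet> (R *v x)) \<and> (\<forall>i. R $ i $ i = 1)"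

text \<open>Operator (spectral) norm of a matrix, as the norm of the induced linear map on Euclidean space.\<close>
definition op_norm2 :: "real^'n^'m \<Rightarrow> real" where
  "op_norm2 A = onorm (\<lambda>x. A *v x)"

text \<open>v is a centered Gaussian random vector with covariance matrix R on the probability space M
  (characteristic-function definition, which also covers singular R).\<close>
definition centered_gaussian_vector :: "'a measure \<Rightarrow> ('a \<Rightarrow> real^'n) \<Rightarrow> real^'n^'n \<Rightarrow> bool" where
  "centered_gaussian_vector M v R \<longleftrightarrow> v \<in> borel_measurable M \<and>
     (\<forall>a. (CLINT \<omega>|M. iexp (a \<bullet> v \<omega>)) = complex_of_real (exp (- (a \<bullet> (R *v a)) / 2)))"

text \<open>Standard normal cumulative distribution function.\<close>
definition Phi :: "real \<Rightarrow> real" where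
  "Phi = cdf (density lborel std_normal_density)"

text \<open>Covariance matrix of a random vector r.\<close>
definition cov_matrix :: "'a measure \<Rightarrow> ('a \<Rightarrow> real^'n) \<Rightarrow> real^'n^'n" where
  "cov_matrix M r = (\<chi> i j. LINT \<omega>|M. (r \<omega> $ i - (LINT \<omega>'|M. r \<omega>' $ i)) * (r \<omega> $ j - (LINT \<omega>'|M. r \<omega>' $ j)))"

end

theory Submission
  imports Defs
begin

text \<open>
  Fourier inversion of the normal density gives \<open>2\<pi> (\<Phi>(x) - \<Phi>(0)) = \<integral> g(s, x) ds\<close> with
  \<open>g(s, x) = exp(-s^2/2) sin(sx) / s\<close>. For a centered Gaussian pair \<open>(X, Y)\<close> with unit
  variances and correlation \<open>\<rho>\<close> the characteristic function gives
  \<open>E[sin(sX) sin(tY)] = exp(-(s^2+t^2)/2) sinh(st\<rho>)\<close>, so by Fubini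
  \<open>Cov(\<Phi>(X), \<Phi>(Y)) = K(\<rho>) / (4\<pi>^2)\<close> with \<open>K(\<rho>) = \<integral>\<integral> exp(-(s^2+t^2)) sinh(st\<rho>) / (st) ds dt\<close>.
  The inequality \<open>sinh(au) - au \<le> a^3 (sinh u - u)\<close> for \<open>0 \<le> a \<le> 1\<close>, \<open>u \<ge> 0\<close> yields
  \<open>|K(\<rho>) - \<pi>\<rho>| \<le> |\<rho>|^3 (K(1) - \<pi>)\<close>, and \<open>K(1) = \<pi>^2/3\<close> because \<open>\<Phi>(X)\<close> is uniform on
  \<open>[0, 1]\<close>. Hence \<open>\<Sigma> = R/(4\<pi>) + E\<close> with \<open>|E_ij| \<le> (1/12 - 1/(4\<pi>)) R_ij^2\<close>, and the
  entrywise square of \<open>R\<close> has operator norm at most \<open>\<parallel>R\<parallel>^2\<close> by Cauchy-Schwarz over the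
  columns of \<open>R\<close>.
\<close>

abbreviation phi :: "real \<Rightarrow> real" where
  "phi \<equiv> std_normal_density"

section \<open>The standard normal distribution function\<close>

lemma Phi_nonneg: "0 \<le> Phi x"
  and Phi_le_1: "Phi x \<le> 1"
proof -
  interpret N: real_distribution "density lborel std_normal_density" by (rule real_dist_normal_dist)
  show "0 \<le> Phi x" "Phi x \<le> 1" unfolding Phi_def by (rule N.cdf_nonneg, rule N.cdf_bounded_prob)
qed

lemma Phi_tendsto_at_bot: "(Phi \<longlongrightarrow> 0) at_bot"
  and Phi_tendsto_at_top: "(Phi \<longlongrightarrow> 1) at_top"
proof -
  interpret N: real_distribution "density lborel std_normal_density" by (rule real_dist_normal_dist)
  show "(Phi \<longlongrightarrow> 0) at_bot" "(Phi \<longlongrightarrow> 1) at_top"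
    unfolding Phi_def by (rule N.cdf_lim_at_bot, rule N.cdf_lim_at_top_prob)
qed

lemma Phi_diff_eq_interval_integral:
  assumes "a \<le> b"
  shows "Phi b - Phi a = (LBINT u=a..b. phi u)"
proof (cases "a = b")
  case False
  interpret N: real_distribution "density lborel std_normal_density" by (rule real_dist_normal_dist)
  have "Phi b - Phi a = measure (density lborel std_normal_density) {a<..b}"
    using assms False unfolding Phi_def by (intro N.cdf_diff_eq) auto
  also have "\<dots> = integral\<^sup>L (density lborel std_normal_density) (indicator {a<..b})"
    by simp
  also have "\<dots> = (LINT u|lborel. phi u * indicator {a<..b} u)"
    by (subst integral_density) auto
  also have "\<dots> = (LBINT u=a..b. phi u)"
    using interval_integral_Ioc[of a b phi] assms
    by (simp add: set_lebesgue_integral_def mult.commute)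
  finally show ?thesis .
qed simp

lemma Phi_minus_Phi_0: "Phi x - Phi 0 = (LBINT u=0..x. phi u)"
proof (cases "0 \<le> x")
  case True
  then show ?thesis
    using Phi_diff_eq_interval_integral[of 0 x] by (simp add: zero_ereal_def)
next
  case False
  then have "Phi 0 - Phi x = (LBINT u=x..0. phi u)"
    using Phi_diff_eq_interval_integral[of x 0] by (simp add: zero_ereal_def)
  then show ?thesis
    by (subst interval_integral_endpoints_reverse) simp
qed

lemma continuous_on_phi: "continuous_on A phi"
  unfolding std_normal_density_def by (intro continuous_intros) auto

lemma has_real_derivative_Phi: "(Phi has_real_derivative phi x) (at x)"
proof -
  have "((\<lambda>u. LBINT y=ereal 0..u. phi y) has_vector_derivative phi x)
      (at x within {- \<bar>x\<bar> - 1..\<bar>x\<bar> + 1})"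
    by (rule interval_integral_FTC2) (auto intro: continuous_on_phi)
  then have "((\<lambda>u. LBINT y=0..u. phi y) has_real_derivative phi x) (at x)"
    by (subst (asm) at_within_interior[of x])
       (auto simp: zero_ereal_def has_real_derivative_iff_has_vector_derivative)
  then have "((\<lambda>u. Phi 0 + (LBINT y=0..u. phi y)) has_real_derivative phi x) (at x)"
    by (auto intro!: derivative_eq_intros)
  moreover have "(\<lambda>u. Phi 0 + (LBINT y=0..u. phi y)) = Phi"
    by (rule ext) (simp add: Phi_minus_Phi_0[symmetric])
  ultimately show ?thesis by simp
qed

lemma isCont_Phi: "isCont Phi x"
  using has_real_derivative_Phi by (rule DERIV_isCont)

lemma borel_measurable_Phi [measurable]: "Phi \<in> borel_measurable borel"
  using isCont_Phi by (intro borel_measurable_continuous_onI continuous_at_imp_continuous_on) auto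

text \<open>The moments of \<open>\<Phi>(X)\<close>, which is uniform on \<open>[0, 1]\<close> for standard normal \<open>X\<close>.\<close>

lemma integral_phi_mult_Phi_power: "(LINT x|lborel. phi x * Phi x ^ k) = 1 / real (Suc k)"
proof -
  define F where "F x = Phi x ^ Suc k / real (Suc k)" for x
  have F': "(F has_real_derivative phi x * Phi x ^ k) (at x)" for x
    unfolding F_def
    using DERIV_cdivide[OF DERIV_power[OF has_real_derivative_Phi[of x], of "Suc k"], of "real (Suc k)"]
    by (simp add: mult_ac)
  have F_at_bot: "((F \<circ> real_of_ereal) \<longlongrightarrow> 0) (at_right (-\<infinity>))"
    unfolding ereal_tendsto_simps F_def
    using Phi_tendsto_at_bot by (auto intro!: tendsto_eq_intros)
  have F_at_top: "((F \<circ> real_of_ereal) \<longlongrightarrow> 1 / real (Suc k)) (at_left \<infinity>)"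
    unfolding ereal_tendsto_simps F_def
    using Phi_tendsto_at_top by (auto intro!: tendsto_eq_intros)
  have cont: "isCont (\<lambda>x. phi x * Phi x ^ k) x" for x
    using isCont_Phi continuous_on_phi[of UNIV]
    by (auto intro!: continuous_intros simp: continuous_on_eq_continuous_at)
  have "(LBINT x=-\<infinity>..\<infinity>. phi x * Phi x ^ k) = 1 / real (Suc k) - 0"
    by (rule interval_integral_FTC_nonneg[OF _ F' cont _ F_at_bot F_at_top]) (auto simp: Phi_nonneg)
  then show ?thesis
    by (simp add: interval_lebesgue_integral_def set_lebesgue_integral_def einterval_eq_UNIV)
qed

section \<open>A Fourier representation of \<open>\<Phi>\<close>\<close>

lemma Re_iexp: "Re (iexp x) = cos x"
  and Im_iexp: "Im (iexp x) = sin x"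
  by (simp_all add: cis_conv_exp[symmetric])

lemma integrable_exp_minus_square_div_2: "integrable lborel (\<lambda>s::real. exp (- s\<^sup>2 / 2))"
proof -
  have "(\<lambda>s::real. exp (- s\<^sup>2 / 2)) = (\<lambda>s. sqrt (2 * pi) * phi s)"
    by (auto simp: std_normal_density_def fun_eq_iff)
  then show ?thesis
    using integrable_normal_density[of 0 1] by simp
qed

lemma integrable_exp_minus_square: "integrable lborel (\<lambda>t::real. exp (- t\<^sup>2))"
  and integral_exp_minus_square: "(LINT t|lborel. exp (- t\<^sup>2)) = sqrt pi"
proof -
  have "normal_density 0 (sqrt (1/2)) t = exp (- t\<^sup>2) / sqrt pi" for t
    using real_sqrt_gt_zero[of "1/2"] by (simp add: normal_density_def)
  then have eq: "exp (- t\<^sup>2) = sqrt pi * normal_density 0 (sqrt (1/2)) t" for t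
    by simp
  show "integrable lborel (\<lambda>t::real. exp (- t\<^sup>2))"
    unfolding eq by (intro integrable_mult_right integrable_normal_density) simp
  show "(LINT t|lborel. exp (- t\<^sup>2)) = sqrt pi"
    unfolding eq by simp
qed

lemma integral_gauss_mult_cos:
  "(LINT s|lborel. exp (- s\<^sup>2 / 2) * cos (s * u)) = sqrt (2 * pi) * exp (- u\<^sup>2 / 2)"
proof -
  interpret N: real_distribution "density lborel std_normal_density" by (rule real_dist_normal_dist)
  have "integrable (density lborel std_normal_density) (\<lambda>x. iexp (u * x))"
    by (rule N.integrable_iexp) auto
  from integral_Re[OF this, symmetric]
  have "Re (char (density lborel std_normal_density) u)
      = (LINT x|density lborel std_normal_density. cos (u * x))"
    unfolding char_def by (simp only: Re_iexp)
  then have "(LINT x|lborel. phi x * cos (u * x)) = exp (- u\<^sup>2 / 2)"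
    by (simp add: char_std_normal_distribution integral_density)
  moreover have "(\<lambda>x. phi x * cos (u * x))
      = (\<lambda>x. (exp (- x\<^sup>2 / 2) * cos (x * u)) / sqrt (2 * pi))"
    by (auto simp: std_normal_density_def mult_ac)
  ultimately show ?thesis
    by (simp add: field_simps)
qed

lemma phi_eq_integral_cos:
  "phi u = (LINT s|lborel. exp (- s\<^sup>2 / 2) * cos (s * u)) / (2 * pi)"
proof -
  have "sqrt (2 * pi) * exp (- u\<^sup>2 / 2) / (2 * pi) = exp (- u\<^sup>2 / 2) / sqrt (2 * pi)"
    by (simp add: field_simps flip: real_sqrt_mult_self[of "2 * pi"])
  then show ?thesis
    unfolding integral_gauss_mult_cos by (simp add: std_normal_density_def)
qed

lemma integral_indicator_mult_cos:
  fixes a b s :: real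
  assumes "a \<le> b" "s \<noteq> 0"
  shows "(LINT u|lborel. indicator {a..b} u * cos (s * u)) = (sin (s * b) - sin (s * a)) / s"
proof -
  have "(LINT u|lborel. indicator {a..b} u * cos (s * u)) = (LBINT u=a..b. cos (s * u))"
    using assms by (simp add: interval_integral_Icc set_lebesgue_integral_def)
  also have "\<dots> = sin (s * b) / s - sin (s * a) / s"
  proof (rule interval_integral_FTC_finite)
    show "continuous_on {min a b..max a b} (\<lambda>u. cos (s * u))"
      by (intro continuous_intros)
    fix x
    have "((\<lambda>u. sin (s * u) / s) has_real_derivative cos (s * x)) (at x)"
      using assms by (auto intro!: derivative_eq_intros)
    then show "((\<lambda>u. sin (s * u) / s) has_vector_derivative cos (s * x)) (at x within {min a b..max a b})"
      by (simp add: has_real_derivative_iff_has_vector_derivative has_vector_derivative_at_within)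
  qed
  finally show ?thesis by (simp add: diff_divide_distrib)
qed

lemma integrable_pair_measure_mult:
  fixes f :: "'a \<Rightarrow> real" and g :: "'b \<Rightarrow> real"
  assumes "pair_sigma_finite M1 M2" "integrable M1 f" "integrable M2 g"
  shows "integrable (M1 \<Otimes>\<^sub>M M2) (\<lambda>p. f (fst p) * g (snd p))"
proof -
  interpret pair_sigma_finite M1 M2 by fact
  have [measurable]: "f \<in> borel_measurable M1" "g \<in> borel_measurable M2"
    using assms by auto
  show ?thesis
  proof (rule Fubini_integrable)
    show "integrable M1 (\<lambda>x. LINT y|M2. norm (f (fst (x, y)) * g (snd (x, y))))"
      using assms(2,3) by (simp add: abs_mult)
    show "AE x in M1. integrable M2 (\<lambda>y. f (fst (x, y)) * g (snd (x, y)))"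
      using assms(3) by simp
  qed measurable
qed

lemma pair_sigma_finite_lborel: "pair_sigma_finite lborel (lborel :: real measure)"
  by (intro pair_sigma_finite.intro lborel.sigma_finite_measure_axioms)

lemma Phi_diff_eq_integral_sin:
  assumes "a \<le> b"
  shows "Phi b - Phi a = (LINT s|lborel. exp (- s\<^sup>2 / 2) * (sin (s * b) - sin (s * a)) / s) / (2 * pi)"
proof -
  define f where "f u s = indicator {a..b} u * (exp (- s\<^sup>2 / 2) * cos (s * u))" for u s :: real
  have "integrable (lborel \<Otimes>\<^sub>M lborel) (case_prod f)"
  proof (rule Bochner_Integration.integrable_bound)
    show "integrable (lborel \<Otimes>\<^sub>M lborel)
        (\<lambda>p::real\<times>real. indicator {a..b} (fst p) * exp (- (snd p)\<^sup>2 / 2))"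
      by (intro integrable_pair_measure_mult pair_sigma_finite_lborel integrable_exp_minus_square_div_2
          integrable_real_indicator) (auto simp: emeasure_lborel_Icc_eq)
    show "AE p in lborel \<Otimes>\<^sub>M lborel.
        norm (case_prod f p) \<le> norm (indicator {a..b} (fst p) * exp (- (snd p)\<^sup>2 / 2) :: real)"
      by (auto simp: f_def abs_mult indicator_def intro!: mult_left_le_one_le)
  qed (unfold f_def, measurable)
  from pair_sigma_finite.Fubini_integral[OF pair_sigma_finite_lborel this]
  have Fubini: "(LINT u|lborel. LINT s|lborel. f u s) = (LINT s|lborel. LINT u|lborel. f u s)"
    by (rule sym)
  have inner: "(LINT u|lborel. f u s) = exp (- s\<^sup>2 / 2) * (sin (s * b) - sin (s * a)) / s"
    if "s \<noteq> 0" for s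
  proof -
    have "(LINT u|lborel. f u s) = (LINT u|lborel. exp (- s\<^sup>2 / 2) * (indicator {a..b} u * cos (s * u)))"
      by (intro Bochner_Integration.integral_cong refl) (simp add: f_def)
    also have "\<dots> = exp (- s\<^sup>2 / 2) * (LINT u|lborel. indicator {a..b} u * cos (s * u))"
      by (rule integral_mult_right_zero)
    finally show ?thesis
      using integral_indicator_mult_cos[OF assms that] by simp
  qed
  have "Phi b - Phi a = (LINT u|lborel. indicator {a..b} u * phi u)"
    using Phi_diff_eq_interval_integral[OF assms] interval_integral_Icc[OF assms, of phi]
    by (simp add: set_lebesgue_integral_def mult.commute)
  also have "\<dots> = (LINT u|lborel. LINT s|lborel. f u s) / (2 * pi)"
    by (simp add: f_def phi_eq_integral_cos)
  also have "(LINT u|lborel. LINT s|lborel. f u s)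
      = (LINT s|lborel. exp (- s\<^sup>2 / 2) * (sin (s * b) - sin (s * a)) / s)"
    unfolding Fubini
    by (intro integral_cong_AE) (use AE_lborel_singleton[of 0] inner in \<open>auto simp: f_def\<close>)
  finally show ?thesis .
qed

text \<open>At \<open>s = 0\<close> the kernel takes the junk value \<open>0\<close>, which is harmless as it is a null set.\<close>

definition gauss_sin_kernel :: "real \<Rightarrow> real \<Rightarrow> real" where
  "gauss_sin_kernel s x = exp (- s\<^sup>2 / 2) * sin (s * x) / s"

lemma measurable_gauss_sin_kernel [measurable (raw)]:
  assumes [measurable]: "f \<in> borel_measurable N" "g \<in> borel_measurable N"
  shows "(\<lambda>x. gauss_sin_kernel (f x) (g x)) \<in> borel_measurable N"
proof -
  have [measurable]: "(\<lambda>x. sin (f x * g x)) \<in> borel_measurable N"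
    using measurable_compose[OF _ borel_measurable_sin, of "\<lambda>x. f x * g x" N] by measurable
  show ?thesis
    unfolding gauss_sin_kernel_def by measurable
qed

lemma integral_gauss_sin_kernel: "(LINT s|lborel. gauss_sin_kernel s x) = 2 * pi * (Phi x - Phi 0)"
proof (cases "0 \<le> x")
  case True
  then show ?thesis
    using Phi_diff_eq_integral_sin[of 0 x] by (simp add: gauss_sin_kernel_def)
next
  case False
  then show ?thesis
    using Phi_diff_eq_integral_sin[of x 0] by (simp add: gauss_sin_kernel_def field_simps)
qed

lemma abs_gauss_sin_kernel_le: "\<bar>gauss_sin_kernel s x\<bar> \<le> exp (- s\<^sup>2 / 2) * \<bar>x\<bar>"
proof (cases "s = 0")
  case False
  have "\<bar>sin (s * x)\<bar> \<le> \<bar>s\<bar> * \<bar>x\<bar>"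
    using abs_sin_x_le_abs_x[of "s * x"] by (simp add: abs_mult)
  then have "\<bar>sin (s * x)\<bar> / \<bar>s\<bar> \<le> \<bar>x\<bar>"
    using False by (simp add: divide_le_eq mult.commute)
  then show ?thesis
    by (simp add: gauss_sin_kernel_def abs_mult abs_divide mult_left_mono flip: times_divide_eq_right)
qed (simp add: gauss_sin_kernel_def)

lemma abs_gauss_sin_kernel_le_inverse: "\<bar>gauss_sin_kernel s x\<bar> \<le> 1 / \<bar>s\<bar>"
proof -
  have "exp (- s\<^sup>2 / 2) * \<bar>sin (s * x)\<bar> \<le> 1"
    by (intro mult_le_one) auto
  then show ?thesis
    by (simp add: gauss_sin_kernel_def abs_mult abs_divide divide_right_mono)
qed

lemma (in prob_space) Fubini_gauss_sin_kernel:
  fixes Z W :: "'a \<Rightarrow> real"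
  assumes [measurable]: "Z \<in> borel_measurable M" "W \<in> borel_measurable M"
    and "integrable M Z" and W_bound: "\<And>\<omega>. \<bar>W \<omega>\<bar> \<le> B"
  shows "integrable lborel (\<lambda>s. LINT \<omega>|M. gauss_sin_kernel s (Z \<omega>) * W \<omega>)"
    and "(LINT \<omega>|M. (LINT s|lborel. gauss_sin_kernel s (Z \<omega>)) * W \<omega>)
      = (LINT s|lborel. LINT \<omega>|M. gauss_sin_kernel s (Z \<omega>) * W \<omega>)"
proof -
  interpret P: pair_sigma_finite lborel M
    by (intro pair_sigma_finite.intro lborel.sigma_finite_measure_axioms sigma_finite_measure_axioms)
  have "0 \<le> B" using W_bound[of undefined] by simp
  have int: "integrable (lborel \<Otimes>\<^sub>M M) (\<lambda>p. gauss_sin_kernel (fst p) (Z (snd p)) * W (snd p))"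
  proof (rule Bochner_Integration.integrable_bound)
    show "integrable (lborel \<Otimes>\<^sub>M M) (\<lambda>p. exp (- (fst p)\<^sup>2 / 2) * (B * \<bar>Z (snd p)\<bar>))"
      using assms(3) by (intro integrable_pair_measure_mult integrable_exp_minus_square_div_2 P.pair_sigma_finite_axioms) auto
    show "AE p in lborel \<Otimes>\<^sub>M M. norm (gauss_sin_kernel (fst p) (Z (snd p)) * W (snd p))
        \<le> norm (exp (- (fst p)\<^sup>2 / 2) * (B * \<bar>Z (snd p)\<bar>))"
    proof (intro AE_I2)
      fix p :: "real \<times> 'a"
      have "\<bar>gauss_sin_kernel (fst p) (Z (snd p))\<bar> * \<bar>W (snd p)\<bar> \<le> (exp (- (fst p)\<^sup>2 / 2) * \<bar>Z (snd p)\<bar>) * B"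
        by (intro mult_mono abs_gauss_sin_kernel_le W_bound) auto
      then show "norm (gauss_sin_kernel (fst p) (Z (snd p)) * W (snd p))
          \<le> norm (exp (- (fst p)\<^sup>2 / 2) * (B * \<bar>Z (snd p)\<bar>))"
        using \<open>0 \<le> B\<close> by (simp add: abs_mult mult_ac)
    qed
  qed measurable
  from P.integrable_fst'[OF int]
  show "integrable lborel (\<lambda>s. LINT \<omega>|M. gauss_sin_kernel s (Z \<omega>) * W \<omega>)" by simp
  show "(LINT \<omega>|M. (LINT s|lborel. gauss_sin_kernel s (Z \<omega>)) * W \<omega>)
      = (LINT s|lborel. LINT \<omega>|M. gauss_sin_kernel s (Z \<omega>) * W \<omega>)"
    using P.Fubini_integral[of "\<lambda>s \<omega>. gauss_sin_kernel s (Z \<omega>) * W \<omega>", unfolded split_beta'] int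
    by simp
qed

section \<open>Correlation matrices\<close>

lemma correlation_matrix_sym: "correlation_matrix R \<Longrightarrow> R $ j $ i = R $ i $ j"
  unfolding correlation_matrix_def by (metis transpose_def vec_lambda_beta)

lemma correlation_matrix_diag: "correlation_matrix R \<Longrightarrow> R $ i $ i = 1"
  unfolding correlation_matrix_def by simp

lemma correlation_matrix_quadratic_form_two_coordinates:
  fixes R :: "real^'n^'n" and s t :: real and i j :: 'n
  assumes "correlation_matrix R"
  defines "a \<equiv> s *\<^sub>R axis i 1 + t *\<^sub>R axis j 1"
  shows "a \<bullet> (R *v a) = s\<^sup>2 + 2 * s * t * R $ i $ j + t\<^sup>2"
  using correlation_matrix_sym[OF assms(1), of i j] correlation_matrix_diag[OF assms(1)]
  by (simp add: a_def matrix_vector_right_distrib matrix_vector_mult_scaleR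
      matrix_vector_mult_basis inner_add_left inner_add_right inner_axis' inner_axis
      column_def power2_eq_square algebra_simps)

lemma correlation_matrix_abs_le_1:
  assumes "correlation_matrix R"
  shows "\<bar>R $ i $ j\<bar> \<le> 1"
proof -
  have psd: "0 \<le> a \<bullet> (R *v a)" for a
    using assms by (simp add: correlation_matrix_def)
  have "0 \<le> 1 + 2 * s * R $ i $ j + 1" if "s\<^sup>2 = 1" for s
    using psd[of "1 *\<^sub>R axis i 1 + s *\<^sub>R axis j 1"] that
    by (simp only: correlation_matrix_quadratic_form_two_coordinates[OF assms]) simp
  from this[of 1] this[of "-1"] show ?thesis by simp
qed

section \<open>Estimates for the hyperbolic sine\<close>

lemma sinh_ge_self:
  fixes x :: real
  assumes "0 \<le> x"
  shows "x \<le> sinh x"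
proof -
  have "(\<lambda>y. sinh y - y) 0 \<le> (\<lambda>y. sinh y - y) x"
  proof (rule DERIV_nonneg_imp_nondecreasing[OF assms])
    fix y :: real
    show "\<exists>d. ((\<lambda>y. sinh y - y) has_real_derivative d) (at y) \<and> 0 \<le> d"
      by (intro exI[of _ "cosh y - 1"] conjI) (auto intro!: derivative_eq_intros simp: cosh_real_ge_1)
  qed
  then show ?thesis by simp
qed

lemma sinh_mult_le:
  fixes a y :: real
  assumes "0 \<le> a" "a \<le> 1" "0 \<le> y"
  shows "sinh (a * y) \<le> a * sinh y"
proof -
  have "(\<lambda>y. a * sinh y - sinh (a * y)) 0 \<le> (\<lambda>y. a * sinh y - sinh (a * y)) y"
  proof (rule DERIV_nonneg_imp_nondecreasing[OF assms(3)])
    fix x :: real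
    assume "0 \<le> x"
    then have "cosh (a * x) \<le> cosh x"
      using assms by (subst cosh_real_nonneg_le_iff) (auto intro: mult_left_le_one_le)
    then have "0 \<le> a * cosh x - cosh (a * x) * a"
      using assms by (simp add: mult_left_mono mult.commute)
    then show "\<exists>d. ((\<lambda>y. a * sinh y - sinh (a * y)) has_real_derivative d) (at x) \<and> 0 \<le> d"
      by (intro exI[of _ "a * cosh x - cosh (a * x) * a"] conjI) (auto intro!: derivative_eq_intros)
  qed
  then show ?thesis by simp
qed

lemma cosh_mult_minus_1_le:
  fixes a y :: real
  assumes "0 \<le> a" "a \<le> 1" "0 \<le> y"
  shows "cosh (a * y) - 1 \<le> a\<^sup>2 * (cosh y - 1)"
proof -
  have "(\<lambda>y. a\<^sup>2 * (cosh y - 1) - (cosh (a * y) - 1)) 0 \<le> (\<lambda>y. a\<^sup>2 * (cosh y - 1) - (cosh (a * y) - 1)) y"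
  proof (rule DERIV_nonneg_imp_nondecreasing[OF assms(3)])
    fix x :: real
    assume "0 \<le> x"
    then have "0 \<le> a * (a * sinh x - sinh (a * x))"
      using assms sinh_mult_le[of a x] by simp
    then have "0 \<le> a\<^sup>2 * sinh x - sinh (a * x) * a"
      by (simp add: power2_eq_square algebra_simps)
    then show "\<exists>d. ((\<lambda>y. a\<^sup>2 * (cosh y - 1) - (cosh (a * y) - 1)) has_real_derivative d) (at x) \<and> 0 \<le> d"
      by (intro exI[of _ "a\<^sup>2 * sinh x - sinh (a * x) * a"] conjI) (auto intro!: derivative_eq_intros)
  qed
  then show ?thesis by simp
qed

lemma sinh_mult_minus_le:
  fixes a y :: real
  assumes "0 \<le> a" "a \<le> 1" "0 \<le> y"
  shows "sinh (a * y) - a * y \<le> a ^ 3 * (sinh y - y)"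
proof -
  have "(\<lambda>y. a ^ 3 * (sinh y - y) - (sinh (a * y) - a * y)) 0 \<le> (\<lambda>y. a ^ 3 * (sinh y - y) - (sinh (a * y) - a * y)) y"
  proof (rule DERIV_nonneg_imp_nondecreasing[OF assms(3)])
    fix x :: real
    assume "0 \<le> x"
    then have "0 \<le> a * (a\<^sup>2 * (cosh x - 1) - (cosh (a * x) - 1))"
      using assms cosh_mult_minus_1_le[of a x] by simp
    then have "0 \<le> a ^ 3 * (cosh x - 1) - (cosh (a * x) * a - a)"
      by (simp add: power2_eq_square power3_eq_cube algebra_simps)
    then show "\<exists>d. ((\<lambda>y. a ^ 3 * (sinh y - y) - (sinh (a * y) - a * y)) has_real_derivative d) (at x) \<and> 0 \<le> d"
      by (intro exI[of _ "a ^ 3 * (cosh x - 1) - (cosh (a * x) * a - a)"] conjI) (auto intro!: derivative_eq_intros)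
  qed
  then show ?thesis by simp
qed

lemma abs_sinh_mult_div_minus_le:
  fixes \<rho> u :: real
  assumes "\<bar>\<rho>\<bar> \<le> 1" "u \<noteq> 0"
  shows "\<bar>sinh (u * \<rho>) / u - \<rho>\<bar> \<le> \<bar>\<rho>\<bar> ^ 3 * (sinh u / u - 1)"
proof -
  define a w where "a = \<bar>\<rho>\<bar>" and "w = \<bar>u\<bar>"
  have a: "0 \<le> a" "a \<le> 1" and w: "0 < w"
    using assms by (auto simp: a_def w_def)
  text \<open>Both sides are even in \<open>u\<close>, and the left one is odd in \<open>\<rho>\<close>.\<close>
  have "\<bar>sinh (u * \<rho>) / u - \<rho>\<bar> = \<bar>sinh (w * a) / w - a\<bar>"
    using assms(2) by (cases "u < 0"; cases "\<rho> < 0") (simp_all add: a_def w_def field_simps)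
  also have "\<dots> = (sinh (a * w) - a * w) / w"
    using sinh_ge_self[of "a * w"] a w by (simp add: field_simps mult.commute)
  also have "\<dots> \<le> a ^ 3 * (sinh w - w) / w"
    using sinh_mult_minus_le[OF a, of w] w by (intro divide_right_mono) auto
  also have "\<dots> = \<bar>\<rho>\<bar> ^ 3 * (sinh u / u - 1)"
    using assms(2) w by (cases "u < 0") (simp_all add: a_def w_def field_simps)
  finally show ?thesis .
qed

section \<open>The covariance kernel\<close>

definition cov_kernel :: "real \<Rightarrow> real \<Rightarrow> real \<Rightarrow> real" where
  "cov_kernel \<rho> s t = exp (- (s\<^sup>2 + t\<^sup>2)) * sinh (s * t * \<rho>) / (s * t)"

definition cov_kernel_integral :: "real \<Rightarrow> real" where
  "cov_kernel_integral \<rho> = (LINT s|lborel. LINT t|lborel. cov_kernel \<rho> s t)"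

lemma abs_cov_kernel_minus_le:
  assumes "\<bar>\<rho>\<bar> \<le> 1" "s \<noteq> 0" "t \<noteq> 0"
  shows "\<bar>cov_kernel \<rho> s t - \<rho> * (exp (- s\<^sup>2) * exp (- t\<^sup>2))\<bar>
    \<le> \<bar>\<rho>\<bar> ^ 3 * (cov_kernel 1 s t - exp (- s\<^sup>2) * exp (- t\<^sup>2))"
proof -
  define E where "E = exp (- s\<^sup>2) * exp (- t\<^sup>2)"
  have E: "0 < E" by (simp add: E_def)
  have st: "s * t \<noteq> 0" using assms by simp
  have kernel: "cov_kernel r s t = E * (sinh ((s * t) * r) / (s * t))" for r
    by (simp add: cov_kernel_def E_def exp_add[symmetric])
  have "cov_kernel \<rho> s t - \<rho> * E = E * (sinh ((s * t) * \<rho>) / (s * t) - \<rho>)"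
    unfolding kernel by (simp add: algebra_simps)
  then have "\<bar>cov_kernel \<rho> s t - \<rho> * E\<bar> = E * \<bar>sinh ((s * t) * \<rho>) / (s * t) - \<rho>\<bar>"
    using E by (simp add: abs_mult)
  also have "\<dots> \<le> E * (\<bar>\<rho>\<bar> ^ 3 * (sinh (s * t) / (s * t) - 1))"
    using abs_sinh_mult_div_minus_le[OF assms(1) st] E by (intro mult_left_mono) auto
  also have "\<dots> = \<bar>\<rho>\<bar> ^ 3 * (cov_kernel 1 s t - E)"
    by (simp add: kernel algebra_simps)
  finally show ?thesis by (simp add: E_def)
qed

lemma abs_integral_le_integral_AE:
  fixes f g :: "'a \<Rightarrow> real"
  assumes "integrable M g" and "AE x in M. \<bar>f x\<bar> \<le> g x"
  shows "\<bar>integral\<^sup>L M f\<bar> \<le> integral\<^sup>L M g"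
proof -
  have "AE x in M. 0 \<le> g x"
    using assms(2) by eventually_elim (rule order_trans[OF abs_ge_zero])
  then have "(LINT x|M. \<bar>f x\<bar>) \<le> integral\<^sup>L M g"
    using assms by (intro integral_mono_AE')
  then show ?thesis
    using integral_abs_bound[of M f] by linarith
qed

text \<open>
  \<open>\<pi>\<rho>\<close> is the integral of the first-order term \<open>\<rho> exp(-s^2) exp(-t^2)\<close> of the kernel. The
  integrability hypotheses are supplied by Fubini's theorem in the probabilistic setting below.
\<close>

lemma
  fixes r :: real
  assumes integrable_inner: "\<And>s. integrable lborel (\<lambda>t. cov_kernel r s t)"
    and integrable_outer: "integrable lborel (\<lambda>s. LINT t|lborel. cov_kernel r s t)"
  shows integrable_cov_kernel_minus_first_order:
      "integrable lborel (\<lambda>s. LINT t|lborel. cov_kernel r s t - r * (exp (- s\<^sup>2) * exp (- t\<^sup>2)))"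
    and integral_cov_kernel_minus_first_order:
      "(LINT s|lborel. LINT t|lborel. cov_kernel r s t - r * (exp (- s\<^sup>2) * exp (- t\<^sup>2)))
        = cov_kernel_integral r - r * pi"
proof -
  have inner: "(LINT t|lborel. cov_kernel r s t - r * (exp (- s\<^sup>2) * exp (- t\<^sup>2)))
      = (LINT t|lborel. cov_kernel r s t) - r * sqrt pi * exp (- s\<^sup>2)" for s
    using integrable_inner integrable_exp_minus_square
    by (simp add: integral_exp_minus_square)
  show "integrable lborel (\<lambda>s. LINT t|lborel. cov_kernel r s t - r * (exp (- s\<^sup>2) * exp (- t\<^sup>2)))"
    unfolding inner
    by (intro Bochner_Integration.integrable_diff integrable_outer integrable_mult_right
        integrable_exp_minus_square)
  show "(LINT s|lborel. LINT t|lborel. cov_kernel r s t - r * (exp (- s\<^sup>2) * exp (- t\<^sup>2)))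
      = cov_kernel_integral r - r * pi"
    unfolding inner
    using integrable_outer integrable_exp_minus_square
    by (simp add: cov_kernel_integral_def integral_exp_minus_square mult.assoc)
qed

lemma abs_cov_kernel_integral_minus_le:
  assumes "\<bar>\<rho>\<bar> \<le> 1"
    and integrable_inner: "\<And>r s. r \<in> {\<rho>, 1} \<Longrightarrow> integrable lborel (\<lambda>t. cov_kernel r s t)"
    and integrable_outer: "\<And>r. r \<in> {\<rho>, 1} \<Longrightarrow> integrable lborel (\<lambda>s. LINT t|lborel. cov_kernel r s t)"
  shows "\<bar>cov_kernel_integral \<rho> - \<rho> * pi\<bar> \<le> \<bar>\<rho>\<bar> ^ 3 * (cov_kernel_integral 1 - pi)"
proof -
  define D where "D r s = (LINT t|lborel. cov_kernel r s t - r * (exp (- s\<^sup>2) * exp (- t\<^sup>2)))" for r s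
  have integrable_D: "integrable lborel (D r)"
    and integral_D: "(LINT s|lborel. D r s) = cov_kernel_integral r - r * pi" if "r \<in> {\<rho>, 1}" for r
    using integrable_cov_kernel_minus_first_order[OF integrable_inner[OF that] integrable_outer[OF that]]
      integral_cov_kernel_minus_first_order[OF integrable_inner[OF that] integrable_outer[OF that]]
    by (simp_all add: D_def[abs_def])
  have abs_D_le: "\<bar>D \<rho> s\<bar> \<le> \<bar>\<rho>\<bar> ^ 3 * D 1 s" if "s \<noteq> 0" for s
  proof -
    have "\<bar>D \<rho> s\<bar> \<le> (LINT t|lborel. \<bar>\<rho>\<bar> ^ 3 * (cov_kernel 1 s t - exp (- s\<^sup>2) * exp (- t\<^sup>2)))"
      unfolding D_def
    proof (rule abs_integral_le_integral_AE)
      show "integrable lborel (\<lambda>t. \<bar>\<rho>\<bar> ^ 3 * (cov_kernel 1 s t - exp (- s\<^sup>2) * exp (- t\<^sup>2)))"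
        using integrable_inner[of 1] integrable_exp_minus_square
        by (intro integrable_mult_right Bochner_Integration.integrable_diff) simp_all
      show "AE t in lborel. \<bar>cov_kernel \<rho> s t - \<rho> * (exp (- s\<^sup>2) * exp (- t\<^sup>2))\<bar>
          \<le> \<bar>\<rho>\<bar> ^ 3 * (cov_kernel 1 s t - exp (- s\<^sup>2) * exp (- t\<^sup>2))"
        using AE_lborel_singleton[of 0] by eventually_elim (rule abs_cov_kernel_minus_le[OF assms(1) that])
    qed
    then show ?thesis
      by (simp add: D_def)
  qed
  have "\<bar>cov_kernel_integral \<rho> - \<rho> * pi\<bar> = \<bar>LINT s|lborel. D \<rho> s\<bar>"
    by (simp add: integral_D)
  also have "\<dots> \<le> (LINT s|lborel. \<bar>\<rho>\<bar> ^ 3 * D 1 s)"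
  proof (rule abs_integral_le_integral_AE)
    show "integrable lborel (\<lambda>s. \<bar>\<rho>\<bar> ^ 3 * D 1 s)"
      by (intro integrable_mult_right integrable_D) simp
    show "AE s in lborel. \<bar>D \<rho> s\<bar> \<le> \<bar>\<rho>\<bar> ^ 3 * D 1 s"
      using AE_lborel_singleton[of 0] by eventually_elim (rule abs_D_le)
  qed
  also have "\<dots> = \<bar>\<rho>\<bar> ^ 3 * (cov_kernel_integral 1 - pi)"
    by (simp add: integral_D)
  finally show ?thesis .
qed

section \<open>An operator norm estimate\<close>

lemma power2_norm_vec: "(norm x)\<^sup>2 = (\<Sum>i\<in>UNIV. (x $ i)\<^sup>2)"
  for x :: "real^'n"
  unfolding power2_norm_eq_inner inner_vec_def by (simp add: power2_eq_square)

lemma sum_column_square_le_onorm: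
  fixes R :: "real^'n^'m"
  shows "(\<Sum>k\<in>UNIV. (R $ k $ i)\<^sup>2) \<le> (onorm ((*v) R))\<^sup>2"
proof -
  have "(\<Sum>k\<in>UNIV. (R $ k $ i)\<^sup>2) = (norm (column i R))\<^sup>2"
    by (simp add: power2_norm_vec column_def)
  also have "\<dots> \<le> (onorm ((*v) R))\<^sup>2"
    by (intro power_mono norm_column_le_onorm) simp
  finally show ?thesis .
qed

lemma sum_weighted_column_square_le_onorm:
  fixes R :: "real^'n^'m" and z :: "real^'n"
  shows "(\<Sum>i\<in>UNIV. \<Sum>j\<in>UNIV. (z $ j)\<^sup>2 * (R $ i $ j)\<^sup>2) \<le> (onorm ((*v) R))\<^sup>2 * (norm z)\<^sup>2"
proof -
  have "(\<Sum>i\<in>UNIV. \<Sum>j\<in>UNIV. (z $ j)\<^sup>2 * (R $ i $ j)\<^sup>2) = (\<Sum>j\<in>UNIV. (z $ j)\<^sup>2 * (\<Sum>i\<in>UNIV. (R $ i $ j)\<^sup>2))"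
    by (subst sum.swap) (simp add: sum_distrib_left)
  also have "\<dots> \<le> (\<Sum>j\<in>UNIV. (z $ j)\<^sup>2 * (onorm ((*v) R))\<^sup>2)"
    by (intro sum_mono mult_left_mono sum_column_square_le_onorm) auto
  also have "\<dots> = (onorm ((*v) R))\<^sup>2 * (norm z)\<^sup>2"
    by (simp add: power2_norm_vec sum_distrib_left mult.commute)
  finally show ?thesis .
qed

text \<open>The left-hand side is the bilinear form of the entrywise square of \<open>R\<close> at \<open>|y|\<close>, \<open>|x|\<close>.\<close>

lemma sum_entrywise_square_le_onorm:
  fixes R :: "real^'n^'n" and x y :: "real^'n"
  assumes sym: "\<And>i j. R $ j $ i = R $ i $ j"
  shows "(\<Sum>i\<in>UNIV. \<Sum>j\<in>UNIV. \<bar>y $ i\<bar> * \<bar>x $ j\<bar> * (R $ i $ j)\<^sup>2)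
    \<le> (onorm ((*v) R))\<^sup>2 * norm x * norm y"
proof -
  define N where "N = onorm ((*v) R)"
  have "0 \<le> N" unfolding N_def by (rule onorm_pos_le) simp
  define S where "S = (\<Sum>i\<in>UNIV. \<Sum>j\<in>UNIV. \<bar>y $ i\<bar> * \<bar>x $ j\<bar> * (R $ i $ j)\<^sup>2)"
  have "S = (\<Sum>p\<in>UNIV \<times> UNIV. (\<bar>y $ fst p\<bar> * \<bar>R $ fst p $ snd p\<bar>) * (\<bar>x $ snd p\<bar> * \<bar>R $ fst p $ snd p\<bar>))"
    unfolding S_def sum.cartesian_product
    by (intro sum.cong refl) (auto simp: power2_eq_square abs_mult_self_eq mult_ac)
  then have "S\<^sup>2 \<le> (\<Sum>p\<in>UNIV \<times> UNIV. (\<bar>y $ fst p\<bar> * \<bar>R $ fst p $ snd p\<bar>)\<^sup>2)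
      * (\<Sum>p\<in>UNIV \<times> UNIV. (\<bar>x $ snd p\<bar> * \<bar>R $ fst p $ snd p\<bar>)\<^sup>2)"
    by (simp only: Cauchy_Schwarz_ineq_sum)
  also have "\<dots> = (\<Sum>i\<in>UNIV. \<Sum>j\<in>UNIV. (y $ j)\<^sup>2 * (R $ i $ j)\<^sup>2)
      * (\<Sum>i\<in>UNIV. \<Sum>j\<in>UNIV. (x $ j)\<^sup>2 * (R $ i $ j)\<^sup>2)"
  proof -
    have "(\<Sum>p\<in>UNIV \<times> UNIV. (\<bar>y $ fst p\<bar> * \<bar>R $ fst p $ snd p\<bar>)\<^sup>2)
        = (\<Sum>i\<in>UNIV. \<Sum>j\<in>UNIV. (y $ i)\<^sup>2 * (R $ j $ i)\<^sup>2)"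
      by (simp add: power_mult_distrib sum.cartesian_product split_beta' sym)
    also have "\<dots> = (\<Sum>j\<in>UNIV. \<Sum>i\<in>UNIV. (y $ i)\<^sup>2 * (R $ j $ i)\<^sup>2)"
      by (rule sum.swap)
    moreover have "(\<Sum>p\<in>UNIV \<times> UNIV. (\<bar>x $ snd p\<bar> * \<bar>R $ fst p $ snd p\<bar>)\<^sup>2)
        = (\<Sum>i\<in>UNIV. \<Sum>j\<in>UNIV. (x $ j)\<^sup>2 * (R $ i $ j)\<^sup>2)"
      by (simp add: power_mult_distrib sum.cartesian_product split_beta')
    ultimately show ?thesis by simp
  qed
  also have "\<dots> \<le> (N\<^sup>2 * (norm y)\<^sup>2) * (N\<^sup>2 * (norm x)\<^sup>2)"
    unfolding N_def
    by (intro mult_mono sum_weighted_column_square_le_onorm sum_nonneg mult_nonneg_nonneg zero_le_power2)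
  also have "\<dots> = (N\<^sup>2 * norm x * norm y)\<^sup>2"
    by (simp add: power_mult_distrib mult_ac)
  finally have "S \<le> N\<^sup>2 * norm x * norm y"
    by (rule power2_le_imp_le) (simp add: \<open>0 \<le> N\<close>)
  then show ?thesis by (simp add: S_def N_def)
qed

lemma inner_matrix_vector_mult:
  fixes A :: "real^'n^'m"
  shows "y \<bullet> (A *v x) = (\<Sum>i\<in>UNIV. \<Sum>j\<in>UNIV. y $ i * A $ i $ j * x $ j)"
  by (simp add: inner_vec_def matrix_vector_mult_def sum_distrib_left mult_ac)

lemma onorm_le_of_entrywise_deviation:
  fixes S R :: "real^'n^'n"
  assumes "0 \<le> c" "0 \<le> c0"
    and sym: "\<And>i j. R $ j $ i = R $ i $ j"
    and deviation: "\<And>i j. \<bar>S $ i $ j - c0 * R $ i $ j\<bar> \<le> c * (R $ i $ j)\<^sup>2"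
  shows "onorm ((*v) S) \<le> c0 * onorm ((*v) R) + c * (onorm ((*v) R))\<^sup>2"
proof (rule onorm_le)
  fix x :: "real^'n"
  define N where "N = onorm ((*v) R)"
  define y where "y = S *v x"
  have "(norm y)\<^sup>2 = y \<bullet> (S *v x)"
    by (simp add: y_def power2_norm_eq_inner)
  also have "\<dots> = c0 * (\<Sum>i\<in>UNIV. \<Sum>j\<in>UNIV. y $ i * R $ i $ j * x $ j)
      + (\<Sum>i\<in>UNIV. \<Sum>j\<in>UNIV. y $ i * x $ j * (S $ i $ j - c0 * R $ i $ j))"
    unfolding inner_matrix_vector_mult by (simp add: sum_distrib_left sum.distrib[symmetric] algebra_simps)
  also have "(\<Sum>i\<in>UNIV. \<Sum>j\<in>UNIV. y $ i * R $ i $ j * x $ j) = y \<bullet> (R *v x)"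
    by (rule inner_matrix_vector_mult[symmetric])
  also have "c0 * (y \<bullet> (R *v x)) \<le> c0 * (N * norm x * norm y)"
  proof (intro mult_left_mono \<open>0 \<le> c0\<close>)
    have "y \<bullet> (R *v x) \<le> norm y * norm (R *v x)"
      by (rule norm_cauchy_schwarz)
    also have "\<dots> \<le> norm y * (N * norm x)"
      unfolding N_def by (intro mult_left_mono onorm[OF matrix_vector_mul_bounded_linear]) simp
    finally show "y \<bullet> (R *v x) \<le> N * norm x * norm y"
      by (simp add: mult_ac)
  qed
  also have "(\<Sum>i\<in>UNIV. \<Sum>j\<in>UNIV. y $ i * x $ j * (S $ i $ j - c0 * R $ i $ j))
      \<le> c * (\<Sum>i\<in>UNIV. \<Sum>j\<in>UNIV. \<bar>y $ i\<bar> * \<bar>x $ j\<bar> * (R $ i $ j)\<^sup>2)"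
    unfolding sum_distrib_left
  proof (intro sum_mono)
    fix i j
    have "y $ i * x $ j * (S $ i $ j - c0 * R $ i $ j) \<le> \<bar>y $ i * x $ j\<bar> * \<bar>S $ i $ j - c0 * R $ i $ j\<bar>"
      by (simp only: abs_mult[symmetric] abs_ge_self)
    also have "\<dots> \<le> \<bar>y $ i * x $ j\<bar> * (c * (R $ i $ j)\<^sup>2)"
      by (intro mult_left_mono deviation) simp
    finally show "y $ i * x $ j * (S $ i $ j - c0 * R $ i $ j) \<le> c * (\<bar>y $ i\<bar> * \<bar>x $ j\<bar> * (R $ i $ j)\<^sup>2)"
      by (simp add: abs_mult mult_ac)
  qed
  also have "\<dots> \<le> c * (N\<^sup>2 * norm x * norm y)"
    unfolding N_def by (intro mult_left_mono sum_entrywise_square_le_onorm sym \<open>0 \<le> c\<close>)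
  finally have "(norm y)\<^sup>2 \<le> (c0 * N + c * N\<^sup>2) * norm x * norm y"
    by (simp add: algebra_simps)
  then have "norm y * norm y \<le> ((c0 * N + c * N\<^sup>2) * norm x) * norm y"
    by (simp add: power2_eq_square mult_ac)
  moreover have "0 \<le> c0 * N + c * N\<^sup>2"
    unfolding N_def using assms(1,2) by (simp add: onorm_pos_le)
  ultimately have "norm y \<le> (c0 * N + c * N\<^sup>2) * norm x"
    by (cases "norm y = 0") (auto intro: mult_right_le_imp_le)
  then show "norm (S *v x) \<le> (c0 * onorm ((*v) R) + c * (onorm ((*v) R))\<^sup>2) * norm x"
    by (simp add: y_def N_def)
qed

section \<open>Covariances of the Gaussian copula\<close>

locale gaussian_copula = prob_space M for M :: "'a measure" +
  fixes R :: "real^'n^'n" and v :: "'a \<Rightarrow> real^'n"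
  assumes correlation: "correlation_matrix R"
    and gaussian: "centered_gaussian_vector M v R"
begin

lemma measurable_coordinate [measurable]: "(\<lambda>\<omega>. v \<omega> $ i) \<in> borel_measurable M"
  using gaussian measurable_compose[OF _ borel_measurable_nth]
  unfolding centered_gaussian_vector_def by blast

lemma char_two_coordinates:
  "(CLINT \<omega>|M. iexp (s * v \<omega> $ i + t * v \<omega> $ j))
    = complex_of_real (exp (- (s\<^sup>2 + 2 * s * t * R $ i $ j + t\<^sup>2) / 2))"
proof -
  define a where "a = s *\<^sub>R axis i 1 + t *\<^sub>R axis j (1::real)"
  have "a \<bullet> w = s * w $ i + t * w $ j" for w :: "real^'n"
    by (simp add: a_def inner_add_left inner_axis')
  moreover have "(CLINT \<omega>|M. iexp (a \<bullet> v \<omega>)) = complex_of_real (exp (- (a \<bullet> (R *v a)) / 2))"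
    using gaussian unfolding centered_gaussian_vector_def by blast
  ultimately show ?thesis
    unfolding a_def correlation_matrix_quadratic_form_two_coordinates[OF correlation] by simp
qed

lemma integral_cos_two_coordinates:
  "(LINT \<omega>|M. cos (s * v \<omega> $ i + t * v \<omega> $ j)) = exp (- (s\<^sup>2 + 2 * s * t * R $ i $ j + t\<^sup>2) / 2)"
  and integral_sin_two_coordinates:
  "(LINT \<omega>|M. sin (s * v \<omega> $ i + t * v \<omega> $ j)) = 0"
proof -
  have "integrable M (\<lambda>\<omega>. iexp (s * v \<omega> $ i + t * v \<omega> $ j))"
    by (intro integrable_iexp) auto
  from integral_Re[OF this] integral_Im[OF this]
  show "(LINT \<omega>|M. cos (s * v \<omega> $ i + t * v \<omega> $ j)) = exp (- (s\<^sup>2 + 2 * s * t * R $ i $ j + t\<^sup>2) / 2)"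
    and "(LINT \<omega>|M. sin (s * v \<omega> $ i + t * v \<omega> $ j)) = 0"
    unfolding char_two_coordinates Re_iexp Im_iexp by simp_all
qed

lemma integral_sin_mult_sin:
  "(LINT \<omega>|M. sin (s * v \<omega> $ i) * sin (t * v \<omega> $ j)) = exp (- (s\<^sup>2 + t\<^sup>2) / 2) * sinh (s * t * R $ i $ j)"
proof -
  have integrable_cos: "integrable M (\<lambda>\<omega>. cos (s * v \<omega> $ i + t * v \<omega> $ j))" for s t
    by (intro integrable_const_bound[where B=1]) auto
  have "sin (s * v \<omega> $ i) * sin (t * v \<omega> $ j)
      = (cos (s * v \<omega> $ i + (- t) * v \<omega> $ j) - cos (s * v \<omega> $ i + t * v \<omega> $ j)) / 2" for \<omega>
    by (simp add: cos_add cos_diff)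
  then have "(LINT \<omega>|M. sin (s * v \<omega> $ i) * sin (t * v \<omega> $ j))
      = ((LINT \<omega>|M. cos (s * v \<omega> $ i + (- t) * v \<omega> $ j)) - (LINT \<omega>|M. cos (s * v \<omega> $ i + t * v \<omega> $ j))) / 2"
    by (simp only: integral_divide_zero Bochner_Integration.integral_diff[OF integrable_cos integrable_cos])
  also have "\<dots> = (exp (- (s\<^sup>2 + t\<^sup>2) / 2 + s * t * R $ i $ j) - exp (- (s\<^sup>2 + t\<^sup>2) / 2 + - (s * t * R $ i $ j))) / 2"
    unfolding integral_cos_two_coordinates by (simp add: field_simps)
  also have "\<dots> = exp (- (s\<^sup>2 + t\<^sup>2) / 2) * sinh (s * t * R $ i $ j)"
    unfolding exp_add sinh_def by (simp add: field_simps)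
  finally show ?thesis .
qed

lemma distr_coordinate: "distr M borel (\<lambda>\<omega>. v \<omega> $ i) = std_normal_distribution"
proof (rule Levy_uniqueness)
  show "char (distr M borel (\<lambda>\<omega>. v \<omega> $ i)) = char std_normal_distribution"
  proof
    fix t
    have "char (distr M borel (\<lambda>\<omega>. v \<omega> $ i)) t = (CLINT \<omega>|M. iexp (t * v \<omega> $ i + 0 * v \<omega> $ i))"
      unfolding char_def by (subst integral_distr) auto
    also have "\<dots> = complex_of_real (exp (- t\<^sup>2 / 2))"
      unfolding char_two_coordinates by simp
    finally show "char (distr M borel (\<lambda>\<omega>. v \<omega> $ i)) t = char std_normal_distribution t"
      by (simp add: char_std_normal_distribution)
  qed
qed (auto intro: real_dist_normal_dist)

lemma integrable_coordinate: "integrable M (\<lambda>\<omega>. v \<omega> $ i)"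
proof -
  have "integrable (distr M borel (\<lambda>\<omega>. v \<omega> $ i)) (\<lambda>x. x)"
    using integrable_std_normal_distribution_moment[of 1] by (simp add: distr_coordinate)
  then show ?thesis
    by (subst (asm) integrable_distr_eq) auto
qed

lemma integral_Phi_coordinate_power: "(LINT \<omega>|M. Phi (v \<omega> $ i) ^ k) = 1 / real (Suc k)"
proof -
  have "(LINT \<omega>|M. Phi (v \<omega> $ i) ^ k) = (LINT x|distr M borel (\<lambda>\<omega>. v \<omega> $ i). Phi x ^ k)"
    by (subst integral_distr) auto
  then show ?thesis
    by (simp add: distr_coordinate integral_density integral_phi_mult_Phi_power)
qed

lemma integrable_Phi_coordinate_power: "integrable M (\<lambda>\<omega>. Phi (v \<omega> $ i) ^ k)"
  by (intro integrable_const_bound[where B=1]) (auto simp: Phi_nonneg Phi_le_1 power_le_one)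

lemma integral_Phi_coordinate: "(LINT \<omega>|M. Phi (v \<omega> $ i)) = Phi 0"
proof -
  have "(LINT \<omega>|M. gauss_sin_kernel s (v \<omega> $ i) * 1) = 0" for s
    using integral_sin_two_coordinates[of s i 0 i]
    by (simp add: gauss_sin_kernel_def)
  then have "(LINT \<omega>|M. (LINT s|lborel. gauss_sin_kernel s (v \<omega> $ i)) * 1) = 0"
    by (subst Fubini_gauss_sin_kernel(2)[where B=1]) (auto simp: integrable_coordinate)
  then have "(LINT \<omega>|M. 2 * pi * (Phi (v \<omega> $ i) - Phi 0)) = 0"
    by (simp add: integral_gauss_sin_kernel)
  then show ?thesis
    using integrable_Phi_coordinate_power[of i 1] by (simp add: prob_space)
qed

abbreviation copula :: "'a \<Rightarrow> real^'n" where
  "copula \<omega> \<equiv> \<chi> i. Phi (v \<omega> $ i)"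

lemma cov_copula_diag: "cov_matrix M copula $ i $ i = 1 / 12"
proof -
  have mean: "(LINT \<omega>|M. Phi (v \<omega> $ i)) = 1 / 2"
    using integral_Phi_coordinate_power[of i 1] by simp
  have "cov_matrix M copula $ i $ i = (LINT \<omega>|M. (Phi (v \<omega> $ i) - 1 / 2) * (Phi (v \<omega> $ i) - 1 / 2))"
    by (simp add: cov_matrix_def mean)
  also have "\<dots> = (LINT \<omega>|M. Phi (v \<omega> $ i) ^ 2 - Phi (v \<omega> $ i) + 1 / 4)"
    by (intro Bochner_Integration.integral_cong refl) (simp add: power2_eq_square field_simps)
  also have "\<dots> = 1 / 12"
    using integrable_Phi_coordinate_power[of i 2] integrable_Phi_coordinate_power[of i 1]
      integral_Phi_coordinate_power[of i 2] integral_Phi_coordinate_power[of i 1]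
    by (simp add: prob_space)
  finally show ?thesis .
qed

lemma integral_kernel_mult_kernel:
  "(LINT \<omega>|M. gauss_sin_kernel t (v \<omega> $ j) * gauss_sin_kernel s (v \<omega> $ i)) = cov_kernel (R $ i $ j) s t"
proof -
  define c where "c = exp (- t\<^sup>2 / 2) * exp (- s\<^sup>2 / 2) / (s * t)"
  have "(LINT \<omega>|M. gauss_sin_kernel t (v \<omega> $ j) * gauss_sin_kernel s (v \<omega> $ i))
      = (LINT \<omega>|M. c * (sin (s * v \<omega> $ i) * sin (t * v \<omega> $ j)))"
    by (intro Bochner_Integration.integral_cong refl) (simp add: gauss_sin_kernel_def c_def field_simps)
  also have "\<dots> = c * (exp (- (s\<^sup>2 + t\<^sup>2) / 2) * sinh (s * t * R $ i $ j))"
    by (simp only: integral_mult_right_zero integral_sin_mult_sin)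
  also have "\<dots> = cov_kernel (R $ i $ j) s t"
  proof -
    have "exp (- t\<^sup>2 / 2) * exp (- s\<^sup>2 / 2) * exp (- (s\<^sup>2 + t\<^sup>2) / 2) = exp (- (s\<^sup>2 + t\<^sup>2))"
      by (simp only: exp_add[symmetric]) (simp add: field_simps)
    then show ?thesis
      unfolding c_def cov_kernel_def by (simp add: field_simps)
  qed
  finally show ?thesis .
qed

lemma
  shows integrable_cov_kernel: "integrable lborel (\<lambda>t. cov_kernel (R $ i $ j) s t)"
    and integral_kernel_mult_Phi:
    "(LINT \<omega>|M. gauss_sin_kernel s (v \<omega> $ i) * (2 * pi * (Phi (v \<omega> $ j) - Phi 0)))
      = (LINT t|lborel. cov_kernel (R $ i $ j) s t)"
proof -
  note Fubini = Fubini_gauss_sin_kernel[of "\<lambda>\<omega>. v \<omega> $ j" "\<lambda>\<omega>. gauss_sin_kernel s (v \<omega> $ i)",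
      OF _ _ integrable_coordinate abs_gauss_sin_kernel_le_inverse]
  have "integrable lborel (\<lambda>t. LINT \<omega>|M. gauss_sin_kernel t (v \<omega> $ j) * gauss_sin_kernel s (v \<omega> $ i))"
    by (rule Fubini(1)) measurable
  then show "integrable lborel (\<lambda>t. cov_kernel (R $ i $ j) s t)"
    by (simp only: integral_kernel_mult_kernel)
  have "(LINT \<omega>|M. (LINT t|lborel. gauss_sin_kernel t (v \<omega> $ j)) * gauss_sin_kernel s (v \<omega> $ i))
      = (LINT t|lborel. LINT \<omega>|M. gauss_sin_kernel t (v \<omega> $ j) * gauss_sin_kernel s (v \<omega> $ i))"
    by (rule Fubini(2)) measurable
  then show "(LINT \<omega>|M. gauss_sin_kernel s (v \<omega> $ i) * (2 * pi * (Phi (v \<omega> $ j) - Phi 0)))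
      = (LINT t|lborel. cov_kernel (R $ i $ j) s t)"
    by (simp only: integral_kernel_mult_kernel integral_gauss_sin_kernel mult.commute)
qed

lemma
  shows integrable_integral_cov_kernel:
    "integrable lborel (\<lambda>s. LINT t|lborel. cov_kernel (R $ i $ j) s t)"
    and cov_copula_eq_cov_kernel_integral:
    "cov_matrix M copula $ i $ j = cov_kernel_integral (R $ i $ j) / (4 * pi\<^sup>2)"
proof -
  have bound: "\<bar>2 * pi * (Phi x - Phi 0)\<bar> \<le> 2 * pi" for x
    using Phi_nonneg[of x] Phi_le_1[of x] Phi_nonneg[of 0] Phi_le_1[of 0] by (simp add: abs_mult)
  note Fubini = Fubini_gauss_sin_kernel[of "\<lambda>\<omega>. v \<omega> $ i" "\<lambda>\<omega>. 2 * pi * (Phi (v \<omega> $ j) - Phi 0)",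
      OF _ _ integrable_coordinate bound]
  have "integrable lborel (\<lambda>s. LINT \<omega>|M. gauss_sin_kernel s (v \<omega> $ i) * (2 * pi * (Phi (v \<omega> $ j) - Phi 0)))"
    by (rule Fubini(1)) measurable
  then show "integrable lborel (\<lambda>s. LINT t|lborel. cov_kernel (R $ i $ j) s t)"
    by (simp only: integral_kernel_mult_Phi)
  have "cov_matrix M copula $ i $ j = (LINT \<omega>|M. (Phi (v \<omega> $ i) - Phi 0) * (Phi (v \<omega> $ j) - Phi 0))"
    by (simp add: cov_matrix_def integral_Phi_coordinate)
  also have "\<dots> = (LINT \<omega>|M. (LINT s|lborel. gauss_sin_kernel s (v \<omega> $ i)) * (2 * pi * (Phi (v \<omega> $ j) - Phi 0)) / (4 * pi\<^sup>2))"
    by (intro Bochner_Integration.integral_cong refl) (simp add: integral_gauss_sin_kernel power2_eq_square)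
  also have "\<dots> = (LINT \<omega>|M. (LINT s|lborel. gauss_sin_kernel s (v \<omega> $ i)) * (2 * pi * (Phi (v \<omega> $ j) - Phi 0))) / (4 * pi\<^sup>2)"
    by (rule integral_divide_zero)
  also have "(LINT \<omega>|M. (LINT s|lborel. gauss_sin_kernel s (v \<omega> $ i)) * (2 * pi * (Phi (v \<omega> $ j) - Phi 0)))
      = (LINT s|lborel. LINT \<omega>|M. gauss_sin_kernel s (v \<omega> $ i) * (2 * pi * (Phi (v \<omega> $ j) - Phi 0)))"
    by (rule Fubini(2)) measurable
  finally show "cov_matrix M copula $ i $ j = cov_kernel_integral (R $ i $ j) / (4 * pi\<^sup>2)"
    by (simp only: integral_kernel_mult_Phi cov_kernel_integral_def)
qed

lemma cov_kernel_integral_1: "cov_kernel_integral 1 = pi\<^sup>2 / 3"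
  using cov_copula_diag[of undefined] cov_copula_eq_cov_kernel_integral[of undefined undefined]
  by (simp add: correlation_matrix_diag[OF correlation] field_simps)

lemma cov_copula_entry_deviation:
  "\<bar>cov_matrix M copula $ i $ j - R $ i $ j / (4 * pi)\<bar> \<le> (1 / 12 - 1 / (4 * pi)) * (R $ i $ j)\<^sup>2"
proof -
  define \<rho> where "\<rho> = R $ i $ j"
  have "\<bar>\<rho>\<bar> \<le> 1"
    unfolding \<rho>_def by (rule correlation_matrix_abs_le_1[OF correlation])
  have estimate: "\<bar>cov_kernel_integral \<rho> - \<rho> * pi\<bar> \<le> \<bar>\<rho>\<bar> ^ 3 * (cov_kernel_integral 1 - pi)"
  proof (rule abs_cov_kernel_integral_minus_le[OF \<open>\<bar>\<rho>\<bar> \<le> 1\<close>])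
    fix r s
    assume "r \<in> {\<rho>, 1}"
    then have "r = R $ i $ j \<or> r = R $ i $ i"
      by (auto simp: \<rho>_def correlation_matrix_diag[OF correlation])
    then show "integrable lborel (\<lambda>t. cov_kernel r s t)"
      and "integrable lborel (\<lambda>s. LINT t|lborel. cov_kernel r s t)"
      using integrable_cov_kernel integrable_integral_cov_kernel by blast+
  qed
  have "cov_kernel_integral \<rho> / (4 * pi\<^sup>2) - \<rho> / (4 * pi) = (cov_kernel_integral \<rho> - \<rho> * pi) / (4 * pi\<^sup>2)"
    by (simp add: power2_eq_square field_simps)
  then have "\<bar>cov_kernel_integral \<rho> / (4 * pi\<^sup>2) - \<rho> / (4 * pi)\<bar>
      \<le> \<bar>\<rho>\<bar> ^ 3 * (cov_kernel_integral 1 - pi) / (4 * pi\<^sup>2)"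
    using estimate by (simp add: abs_divide divide_right_mono)
  also have "\<dots> = \<bar>\<rho>\<bar> ^ 3 * (1 / 12 - 1 / (4 * pi))"
    by (simp add: cov_kernel_integral_1 power2_eq_square field_simps)
  also have "\<dots> \<le> \<rho>\<^sup>2 * (1 / 12 - 1 / (4 * pi))"
  proof (rule mult_right_mono)
    show "\<bar>\<rho>\<bar> ^ 3 \<le> \<rho>\<^sup>2"
      using \<open>\<bar>\<rho>\<bar> \<le> 1\<close> mult_right_mono[OF \<open>\<bar>\<rho>\<bar> \<le> 1\<close>, of "\<rho>\<^sup>2"]
      by (simp add: power3_eq_cube power2_eq_square abs_mult_self_eq)
    show "0 \<le> 1 / 12 - 1 / (4 * pi)"
      using pi_gt3 by (simp add: field_simps)
  qed
  finally show ?thesis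
    by (simp add: \<rho>_def cov_copula_eq_cov_kernel_integral mult.commute)
qed

end

theorem fact2:
  fixes M :: "'a measure" and R :: "real^'n^'n" and v :: "'a \<Rightarrow> real^'n"
  assumes "prob_space M"
    and "correlation_matrix R"
    and "centered_gaussian_vector M v R"
  shows "op_norm2 (cov_matrix M (\<lambda>\<omega>. \<chi> i. Phi (v \<omega> $ i)))
           \<le> 1 / (2 * pi) * (op_norm2 R / 2 + 4 * (op_norm2 R)\<^sup>2 * (pi / 6 - 1 / 2))"
proof -
  interpret gaussian_copula M R v
    using assms by (simp add: gaussian_copula_def gaussian_copula_axioms_def)
  define N where "N = op_norm2 R"
  have deviation: "\<bar>cov_matrix M copula $ i $ j - 1 / (4 * pi) * R $ i $ j\<bar>
      \<le> (1 / 12 - 1 / (4 * pi)) * (R $ i $ j)\<^sup>2" for i j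
    using cov_copula_entry_deviation[of i j] by simp
  have "0 \<le> 1 / 12 - 1 / (4 * pi)"
    using pi_gt3 by (simp add: field_simps)
  then have "op_norm2 (cov_matrix M copula) \<le> 1 / (4 * pi) * N + (1 / 12 - 1 / (4 * pi)) * N\<^sup>2"
    unfolding op_norm2_def N_def
    by (rule onorm_le_of_entrywise_deviation[OF _ _ correlation_matrix_sym[OF correlation] deviation]) simp
  also have "\<dots> \<le> 1 / (4 * pi) * N + (1 / 3 - 1 / pi) * N\<^sup>2"
    using pi_gt3 by (intro add_left_mono mult_right_mono) (auto simp: field_simps)
  also have "\<dots> = 1 / (2 * pi) * (N / 2 + 4 * N\<^sup>2 * (pi / 6 - 1 / 2))"
    by (simp add: field_simps)
  finally show ?thesis
    unfolding N_def .
qed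

end
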